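(* Let $D\subseteq\mathbb{R}$ be an interval with nonempty interior and $T>0$. Let $u\in C^1([0,T];C^2(D))$ be a given function which, for some $\kappa\in C^1(D)$, satisfies $$\frac{\partial}{\partial t}u(t,x)-\frac{\partial}{\partial x}\Big(\kappa(x)\frac{\partial}{\partial x}u(t,x)\Big)=0,\qquad \forall (t,x)\in[0,T]\times D. \quad (\ast)$$ If for every nonempty open interval $\Omega\subseteq D$ there exists a temporal interval $(T_1,T_2)\subset[0,T]$ such that $\frac{\partial}{\partial x}u(t,x)$ is not separable on $(T_1,T_2)\times\Omega$, then $\kappa$ is unique, i.e. $\kappa$ is the only function in $C^1(D)$ for which $(\ast)$ holds with the given $u$.
   Context: A $C^1$ function $h$ of two variables $(t,x)\in(T_1,T_2)\times\Omega$ is called separable on $(T_1,T_2)\times\Omega$ if there exist $f\in C^1(T_1,T_2)$ and $g\in C^1(\Omega)$ such that $h(t,x)=f(t)g(x)$ for all $(t,x)\in(T_1,T_2)\times\Omega$. $C^1([0,T];C^2(D))$ denotes the functions $u(t,x)$ for which $t\mapsto u(t,\cdot)$ is a continuously differentiable map from $[0,T]$ into $C^2(D)$. *)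

theory Defs
  imports "HOL-Analysis.Analysis"
begin

text \<open>Derivatives are taken within the domain, hence one-sided at an endpoint that belongs to it.\<close>

definition deriv_within :: "real set \<Rightarrow> (real \<Rightarrow> real) \<Rightarrow> real \<Rightarrow> real" where
  "deriv_within S f x = vector_derivative f (at x within S)"

text \<open>The class \<open>C\<^sup>k(S)\<close>. The library's \<open>C1_differentiable_on\<close> demands two-sided derivatives,
  so it is not suitable when \<open>S\<close> contains an endpoint.\<close>

definition Ck_on :: "nat \<Rightarrow> real set \<Rightarrow> (real \<Rightarrow> real) \<Rightarrow> bool" where
  "Ck_on k S f \<longleftrightarrow>
     (\<forall>j<k. \<forall>x\<in>S. (deriv_within S ^^ j) f differentiable (at x within S)) \<and>
     continuous_on S ((deriv_within S ^^ k) f)"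

text \<open>Convergence in \<open>C\<^sup>k(S)\<close>: uniform convergence of all derivatives up to order \<open>k\<close> on compact
  subsets of \<open>S\<close>. For compact \<open>S\<close> this is convergence in the usual \<open>C\<^sup>k\<close> norm; otherwise it is
  the usual Frechet topology, which is weaker than that of the \<open>C\<^sup>k\<close> norm.\<close>

definition Ck_tendsto ::
    "nat \<Rightarrow> real set \<Rightarrow> ('a \<Rightarrow> real \<Rightarrow> real) \<Rightarrow> (real \<Rightarrow> real) \<Rightarrow> 'a filter \<Rightarrow> bool" where
  "Ck_tendsto k S f l F \<longleftrightarrow>
     (\<forall>K j. compact K \<longrightarrow> K \<subseteq> S \<longrightarrow> j \<le> k \<longrightarrow>
        uniform_limit K (\<lambda>s. (deriv_within S ^^ j) (f s)) ((deriv_within S ^^ j) l) F)"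

text \<open>The class \<open>C\<^sup>1(I; C\<^sup>k(S))\<close>; \<open>v\<close> is the derivative of the \<open>C\<^sup>k(S)\<close>-valued map
  \<open>t \<mapsto> u t\<close>.\<close>

definition C1_into_Ck :: "real set \<Rightarrow> nat \<Rightarrow> real set \<Rightarrow> (real \<Rightarrow> real \<Rightarrow> real) \<Rightarrow> bool" where
  "C1_into_Ck I k S u \<longleftrightarrow>
     (\<exists>v. \<forall>t\<in>I. Ck_on k S (u t) \<and> Ck_on k S (v t) \<and>
        Ck_tendsto k S (\<lambda>s x. (u s x - u t x) / (s - t)) (v t) (at t within I) \<and>
        Ck_tendsto k S v (v t) (at t within I))"

definition satisfies_diffusion_eq ::
    "real \<Rightarrow> real set \<Rightarrow> (real \<Rightarrow> real) \<Rightarrow> (real \<Rightarrow> real \<Rightarrow> real) \<Rightarrow> bool" where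
  "satisfies_diffusion_eq T D \<kappa> u \<longleftrightarrow>
     (\<forall>t\<in>{0..T}. \<forall>x\<in>D.
        deriv_within {0..T} (\<lambda>s. u s x) t
        - deriv_within D (\<lambda>y. \<kappa> y * deriv_within D (u t) y) x = 0)"

text \<open>Used for open \<open>\<Omega>\<close> only. That \<open>h\<close> is itself \<open>C\<^sup>1\<close> on the product follows from the
  factorization.\<close>

definition separable_on ::
    "real \<Rightarrow> real \<Rightarrow> real set \<Rightarrow> (real \<Rightarrow> real \<Rightarrow> real) \<Rightarrow> bool" where
  "separable_on T1 T2 \<Omega> h \<longleftrightarrow>
     (\<exists>f g. f C1_differentiable_on {T1<..<T2} \<and> g C1_differentiable_on \<Omega> \<and>
        (\<forall>t\<in>{T1<..<T2}. \<forall>x\<in>\<Omega>. h t x = f t * g x))"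

end

theory Submission
  imports Defs
begin

text \<open>The difference \<open>\<eta>\<close> of two admissible coefficients satisfies \<open>(\<eta> u\<^sub>x)\<^sub>x = 0\<close> for every time.
  If \<open>\<eta>\<close> is nonzero somewhere, it is nonzero on an open interval \<open>\<Omega> \<subseteq> D\<close>. There
  \<open>\<eta> u\<^sub>x\<close> depends on \<open>t\<close> only, so \<open>u\<^sub>x = c(t) / \<eta>(x)\<close> is separable on \<open>\<Omega>\<close> for every time interval.\<close>

lemma has_deriv_within_interior:
  assumes "f differentiable (at x within S)" and "x \<in> interior S"
  shows "(f has_field_derivative deriv_within S f x) (at x)"
proof -
  have "at x within S = at x"
    using assms(2) by (rule at_within_interior)
  with assms(1) show ?thesis
    by (simp add: deriv_within_def vector_derivative_works
        has_real_derivative_iff_has_vector_derivative)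
qed

text \<open>At an interior point the filter within \<open>S\<close> is the full one, so the
  derivative is two-sided and unique. This lets the ordinary calculus rules evaluate
  \<open>deriv_within\<close>.\<close>

lemma deriv_within_interior_eq:
  assumes "(f has_field_derivative d) (at x)" and "x \<in> interior S"
  shows "deriv_within S f x = d"
proof -
  have "at x within S = at x"
    using assms(2) by (rule at_within_interior)
  with assms(1) show ?thesis
    by (simp add: deriv_within_def vector_derivative_at
        has_real_derivative_iff_has_vector_derivative)
qed

lemma Ck_on_has_deriv:
  assumes "Ck_on k S f" and "j < k" and "x \<in> interior S"
  shows "((deriv_within S ^^ j) f has_field_derivative (deriv_within S ^^ Suc j) f x) (at x)"
proof -
  have "x \<in> S"
    using assms(3) interior_subset by blast
  then have "(deriv_within S ^^ j) f differentiable (at x within S)"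
    using assms(1,2) by (simp add: Ck_on_def)
  then show ?thesis
    using has_deriv_within_interior[OF _ assms(3)] by simp
qed

lemma Ck_on_continuous_on:
  assumes "Ck_on k S f"
  shows "continuous_on S f"
proof (cases k)
  case 0
  with assms show ?thesis by (simp add: Ck_on_def)
next
  case (Suc m)
  with assms have "f differentiable (at x within S)" if "x \<in> S" for x
    using that unfolding Ck_on_def by (metis funpow_0 zero_less_Suc)
  then show ?thesis
    by (simp add: continuous_on_eq_continuous_within differentiable_imp_continuous_within)
qed

text \<open>A singleton is a compact subset of \<open>S\<close>, so uniform convergence on compact
  sets can be evaluated at one point.\<close>

lemma Ck_tendsto_pointwise:
  assumes "Ck_tendsto k S f l F" and "x \<in> S" and "j \<le> k"
  shows "((\<lambda>s. (deriv_within S ^^ j) (f s) x) \<longlongrightarrow> (deriv_within S ^^ j) l x) F"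
proof -
  have "uniform_limit {x} (\<lambda>s. (deriv_within S ^^ j) (f s)) ((deriv_within S ^^ j) l) F"
    using assms unfolding Ck_tendsto_def by (metis compact_sing empty_subsetI insert_subset)
  then show ?thesis
    by (rule tendsto_uniform_limitI) simp
qed

text \<open>Taking the first x-derivative at a fixed point is linear and continuous on
  \<open>C\<^sup>k(S)\<close> for k \<ge> 1. It therefore commutes with the derivative in t, and the
  t-derivative of u_x is v_x. This supplies the regularity of the time factor in the
  separation.\<close>

lemma C1_into_Ck_deriv_C1:
  assumes u: "C1_into_Ck I k S u" and "k \<ge> 1" and x: "x \<in> interior S"
    and J: "open J" "J \<subseteq> I"
  shows "(\<lambda>t. deriv_within S (u t) x) C1_differentiable_on J"
proof -
  obtain v where "\<forall>t\<in>I. Ck_on k S (u t) \<and> Ck_on k S (v t) \<and>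
      Ck_tendsto k S (\<lambda>s x. (u s x - u t x) / (s - t)) (v t) (at t within I) \<and>
      Ck_tendsto k S v (v t) (at t within I)"
    using u unfolding C1_into_Ck_def by (elim exE)
  then have v: "Ck_on k S (u t)"
      "Ck_tendsto k S (\<lambda>s x. (u s x - u t x) / (s - t)) (v t) (at t within I)"
      "Ck_tendsto k S v (v t) (at t within I)" if "t \<in> I" for t
    using that by simp_all
  have xS: "x \<in> S"
    using x interior_subset by blast
  \<comment> \<open>Since \<open>J\<close> is open, each of its points is interior to
    \<open>I\<close>. The limits within \<open>I\<close> are thus the two-sided ones that
    \<open>C1_differentiable_on\<close> demands.\<close>
  have at: "t \<in> I" "at t within I = at t" if "t \<in> J" for t
    using that J at_within_interior[of t I] interior_maximal[of J I] by auto
  have du: "(u t has_field_derivative deriv_within S (u t) x) (at x)" if "t \<in> J" for t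
    using Ck_on_has_deriv[OF v(1)[OF at(1)[OF that]], of 0 x] x \<open>k \<ge> 1\<close> by simp
  have "((\<lambda>t. deriv_within S (u t) x) has_vector_derivative deriv_within S (v t) x) (at t)"
    if t: "t \<in> J" for t
  proof -
    have "((\<lambda>s. deriv_within S (\<lambda>y. (u s y - u t y) / (s - t)) x)
        \<longlongrightarrow> deriv_within S (v t) x) (at t)"
      using Ck_tendsto_pointwise[OF v(2)[OF at(1)[OF t]] xS, of 1] \<open>k \<ge> 1\<close> at(2)[OF t] by simp
    \<comment> \<open>Differentiating the quotient in x term by term needs \<open>u s\<close> to be
      differentiable at \<open>x\<close>, which \<open>du\<close> provides for s in
      \<open>J\<close>, hence for all s near t.\<close>
    moreover have "\<forall>\<^sub>F s in at t. s \<in> J"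
      using \<open>open J\<close> t by (simp add: eventually_at_in_open')
    then have "\<forall>\<^sub>F s in at t. deriv_within S (\<lambda>y. (u s y - u t y) / (s - t)) x
        = (deriv_within S (u s) x - deriv_within S (u t) x) / (s - t)"
    proof (rule eventually_mono)
      fix s assume "s \<in> J"
      then show "deriv_within S (\<lambda>y. (u s y - u t y) / (s - t)) x
          = (deriv_within S (u s) x - deriv_within S (u t) x) / (s - t)"
        using t by (intro deriv_within_interior_eq[OF _ x] DERIV_cdivide DERIV_diff du)
    qed
    ultimately have "((\<lambda>s. (deriv_within S (u s) x - deriv_within S (u t) x) / (s - t))
        \<longlongrightarrow> deriv_within S (v t) x) (at t)"
      by (rule Lim_transform_eventually)
    then show ?thesis
      by (simp add: has_real_derivative_iff_has_vector_derivative[symmetric] has_field_derivative_iff)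
  qed
  moreover have "continuous_on J (\<lambda>t. deriv_within S (v t) x)"
  proof -
    have "((\<lambda>s. deriv_within S (v s) x) \<longlongrightarrow> deriv_within S (v t) x) (at t)" if "t \<in> J" for t
      using Ck_tendsto_pointwise[OF v(3)[OF at(1)[OF that]] xS, of 1] \<open>k \<ge> 1\<close> at(2)[OF that] by simp
    then show ?thesis
      by (simp add: continuous_at_imp_continuous_on isCont_def)
  qed
  ultimately show ?thesis
    unfolding C1_differentiable_on_def by (intro exI conjI ballI)
qed

text \<open>By continuity \<open>h\<close> is nonzero on a relatively open part of \<open>D\<close>
  around \<open>x\<close>. Any small ball around an interior point of \<open>D\<close> in that part
  will do.\<close>

lemma open_interval_nonzero:
  fixes D :: "real set" and h :: "real \<Rightarrow> real"
  assumes "is_interval D" "interior D \<noteq> {}" "continuous_on D h" "x \<in> D" "h x \<noteq> 0"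
  obtains \<Omega> where "is_interval \<Omega>" "open \<Omega>" "\<Omega> \<noteq> {}" "\<Omega> \<subseteq> D" "\<And>y. y \<in> \<Omega> \<Longrightarrow> h y \<noteq> 0"
proof -
  obtain U where U: "open U" "U \<inter> D = h -` (- {0}) \<inter> D"
    using assms(3) by (metis continuous_on_open_invariant open_Compl closed_singleton)
  \<comment> \<open>The point \<open>x\<close> may be an endpoint of \<open>D\<close>. A convex set
    with nonempty interior lies in the closure of that interior, so interior points exist
    arbitrarily close to \<open>x\<close>.\<close>
  have "x \<in> closure (interior D)"
    using assms closure_subset by (auto simp: is_interval_convex_1 convex_closure_interior)
  moreover have "x \<in> U"
    using U assms by blast
  ultimately obtain y where y: "y \<in> U \<inter> interior D"
    using \<open>open U\<close> by (meson disjoint_iff open_Int_closure_eq_empty Int_iff)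
  then obtain e where "e > 0" and e: "ball y e \<subseteq> U \<inter> interior D"
    using \<open>open U\<close> by (meson open_Int open_contains_ball open_interior)
  show ?thesis
  proof
    show "ball y e \<subseteq> D"
      using e interior_subset by blast
    then show "h z \<noteq> 0" if "z \<in> ball y e" for z
      using that e U(2) by blast
  qed (use \<open>e > 0\<close> in \<open>auto simp: is_interval_convex_1\<close>)
qed

lemma separable_on_diffusion_difference:
  assumes \<Omega>: "is_interval \<Omega>" "open \<Omega>" "\<Omega> \<noteq> {}" "\<Omega> \<subseteq> D"
    and u: "C1_into_Ck {0..T} 2 D u"
    and \<kappa>: "Ck_on 1 D \<kappa>" "satisfies_diffusion_eq T D \<kappa> u"
    and \<kappa>': "Ck_on 1 D \<kappa>'" "satisfies_diffusion_eq T D \<kappa>' u"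
    and neq: "\<And>x. x \<in> \<Omega> \<Longrightarrow> \<kappa>' x - \<kappa> x \<noteq> 0"
    and T12: "0 \<le> T1" "T2 \<le> T"
  shows "separable_on T1 T2 \<Omega> (\<lambda>t x. deriv_within D (u t) x)"
proof -
  define \<eta> where "\<eta> x = \<kappa>' x - \<kappa> x" for x
  define p where "p t x = deriv_within D (u t) x" for t x
  have int: "x \<in> interior D" if "x \<in> \<Omega>" for x
    using \<Omega> that interior_maximal by blast
  have d\<kappa>: "(\<kappa> has_field_derivative deriv_within D \<kappa> x) (at x)"
    and d\<kappa>': "(\<kappa>' has_field_derivative deriv_within D \<kappa>' x) (at x)" if "x \<in> \<Omega>" for x
    using Ck_on_has_deriv[OF \<kappa>(1), of 0] Ck_on_has_deriv[OF \<kappa>'(1), of 0] int[OF that] by auto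
  \<comment> \<open>A base point makes the constant explicit: c(t) is the value of \<eta> u_x there,
    so its smoothness in t follows from that of u_x at one fixed point.\<close>
  obtain x\<^sub>0 where x0: "x\<^sub>0 \<in> \<Omega>"
    using \<Omega>(3) by blast
  have flux: "\<eta> x * p t x = \<eta> x\<^sub>0 * p t x\<^sub>0" if t: "t \<in> {0..T}" and x: "x \<in> \<Omega>" for t x
  proof -
    have C2: "Ck_on 2 D (u t)"
      using u t unfolding C1_into_Ck_def by blast
    have "((\<lambda>y. \<eta> y * p t y) has_field_derivative 0) (at y within \<Omega>)" if y: "y \<in> \<Omega>" for y
    proof -
      \<comment> \<open>Second-order regularity of \<open>u t\<close> makes both fluxes
        differentiable, so their \<open>deriv_within\<close> values are genuine derivatives and may
        be subtracted.\<close>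
      have dp: "(p t has_field_derivative deriv_within D (p t) y) (at y)"
        using Ck_on_has_deriv[OF C2, of 1 y] int[OF y] by (simp add: p_def[abs_def])
      note d = DERIV_mult[OF d\<kappa>[OF y] dp] and d' = DERIV_mult[OF d\<kappa>'[OF y] dp]
      \<comment> \<open>By the two equations, both sides equal the same time derivative of u at (t,
        y).\<close>
      have "deriv_within D (\<lambda>z. \<kappa>' z * p t z) y = deriv_within D (\<lambda>z. \<kappa> z * p t z) y"
        using \<kappa>(2) \<kappa>'(2) t y \<Omega>(4) unfolding satisfies_diffusion_eq_def p_def
        by (metis (no_types, lifting) eq_iff_diff_eq_0 subsetD)
      then have "((\<lambda>z. \<kappa>' z * p t z - \<kappa> z * p t z) has_field_derivative 0) (at y)"
        using DERIV_diff[OF d' d] deriv_within_interior_eq[OF d int[OF y]]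
          deriv_within_interior_eq[OF d' int[OF y]] by simp
      then show ?thesis
        by (simp add: \<eta>_def left_diff_distrib has_field_derivative_at_within)
    qed
    then obtain c where "\<And>y. y \<in> \<Omega> \<Longrightarrow> \<eta> y * p t y = c"
      using has_field_derivative_zero_constant[of \<Omega>] \<Omega>(1) by (metis is_interval_convex)
    then show ?thesis
      using x x0 by simp
  qed
  have "(\<lambda>t. \<eta> x\<^sub>0 * p t x\<^sub>0) C1_differentiable_on {T1<..<T2}"
    unfolding p_def using T12
    by (intro C1_differentiable_on_mult C1_differentiable_on_const
        C1_into_Ck_deriv_C1[OF u] int x0) auto
  moreover have "(\<lambda>x. 1 / \<eta> x) C1_differentiable_on \<Omega>"
  proof -
    \<comment> \<open>This is the derivative of \<eta>, continuous because both coefficients are of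
      class C1. The quotient rule then gives the derivative of 1 / \<eta>, as \<eta> has no zero on
      \<Omega>.\<close>
    define \<eta>' where "\<eta>' x = deriv_within D \<kappa>' x - deriv_within D \<kappa> x" for x
    have "continuous_on \<Omega> \<eta>'" "continuous_on \<Omega> \<eta>"
      using \<kappa>(1) \<kappa>'(1) Ck_on_continuous_on[OF \<kappa>(1)] Ck_on_continuous_on[OF \<kappa>'(1)] \<Omega>(4)
      by (auto simp: \<eta>'_def[abs_def] \<eta>_def[abs_def] Ck_on_def
          intro!: continuous_on_diff elim: continuous_on_subset)
    then have "continuous_on \<Omega> (\<lambda>x. - \<eta>' x / (\<eta> x * \<eta> x))"
      using neq by (intro continuous_intros) (auto simp: \<eta>_def)
    moreover have "((\<lambda>x. 1 / \<eta> x) has_vector_derivative - \<eta>' x / (\<eta> x * \<eta> x)) (at x)"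
      if "x \<in> \<Omega>" for x
      unfolding has_real_derivative_iff_has_vector_derivative[symmetric] \<eta>_def \<eta>'_def
      using neq[OF that] by (auto intro!: derivative_eq_intros d\<kappa> d\<kappa>' that)
    ultimately show ?thesis
      unfolding C1_differentiable_on_def by (intro exI conjI ballI)
  qed
  moreover have "p t x = \<eta> x\<^sub>0 * p t x\<^sub>0 * (1 / \<eta> x)" if "t \<in> {T1<..<T2}" "x \<in> \<Omega>" for t x
    using flux[of t x] neq[of x] that T12 by (simp add: \<eta>_def field_simps)
  ultimately show ?thesis
    unfolding separable_on_def p_def[symmetric] by (intro exI conjI ballI)
qed

theorem theorem3p5:
  fixes D :: "real set" and T :: real
    and u :: "real \<Rightarrow> real \<Rightarrow> real" and \<kappa> :: "real \<Rightarrow> real"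
  assumes "is_interval D" and "interior D \<noteq> {}" and "T > 0"
    and "C1_into_Ck {0..T} 2 D u"
    and "Ck_on 1 D \<kappa>" and "satisfies_diffusion_eq T D \<kappa> u"
    and "\<And>\<Omega>. is_interval \<Omega> \<Longrightarrow> open \<Omega> \<Longrightarrow> \<Omega> \<noteq> {} \<Longrightarrow> \<Omega> \<subseteq> D \<Longrightarrow>
           \<exists>T1 T2. 0 \<le> T1 \<and> T1 < T2 \<and> T2 \<le> T \<and>
             \<not> separable_on T1 T2 \<Omega> (\<lambda>t x. deriv_within D (u t) x)"
  shows "\<forall>\<kappa>'. Ck_on 1 D \<kappa>' \<and> satisfies_diffusion_eq T D \<kappa>' u \<longrightarrow> (\<forall>x\<in>D. \<kappa>' x = \<kappa> x)"
proof (intro allI impI ballI)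
  fix \<kappa>' x
  assume \<kappa>': "Ck_on 1 D \<kappa>' \<and> satisfies_diffusion_eq T D \<kappa>' u" and x: "x \<in> D"
  show "\<kappa>' x = \<kappa> x"
  proof (rule ccontr)
    assume "\<kappa>' x \<noteq> \<kappa> x"
    moreover have "continuous_on D (\<lambda>y. \<kappa>' y - \<kappa> y)"
      using \<kappa>' assms(5) by (intro continuous_on_diff Ck_on_continuous_on) auto
    ultimately obtain \<Omega> where \<Omega>: "is_interval \<Omega>" "open \<Omega>" "\<Omega> \<noteq> {}" "\<Omega> \<subseteq> D"
      and neq: "\<And>y. y \<in> \<Omega> \<Longrightarrow> \<kappa>' y - \<kappa> y \<noteq> 0"
      using open_interval_nonzero[OF assms(1,2) _ x, of "\<lambda>y. \<kappa>' y - \<kappa> y"] by auto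
    then show False
      \<comment> \<open>The hypothesis yields one time interval on which u_x is not separable over
        \<Omega>, whereas the difference argument makes it separable on every time interval inside
        [0, T].\<close>
      using assms(7)[OF \<Omega>] separable_on_diffusion_difference[OF \<Omega> assms(4-6) _ _ neq] \<kappa>' by blast
  qed
qed

end
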